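(* The map $\Psi:(\mathcal{G}_0,d^{L^2})\to(\mathcal{P}_0,d^W)$, $\Psi(g)=g_*\mathrm{Leb}$, is an isometry (a distance-preserving bijection). Its inverse is given by $\Psi^{-1}(\mu)=g_\mu$, where $g_\mu$ is the inverse distribution function $$g_\mu(t):=\inf\{s\in[0,1]:\mu([0,s])>t\},\qquad t\in[0,1],$$ with the convention $\inf\emptyset:=1$.
   Context: $\mathrm{Leb}$ is Lebesgue measure on $[0,1]$, and $g_*\mathrm{Leb}$ is the pushforward, $g_*\mathrm{Leb}(A)=\mathrm{Leb}(g^{-1}(A))$ for Borel $A\subset[0,1]$. $\mathcal{P}_0=\mathcal{P}([0,1])$ is the set of Borel probability measures on $[0,1]$, equipped with the ($2$-)Wasserstein distance $$d^W(\mu,\nu)^2=\inf_{\pi\in\Pi(\mu,\nu)}\int_{[0,1]\times[0,1]}|x-y|^2\,d\pi(x,y),$$ where $\Pi(\mu,\nu)$ is the set of Borel probability measures on $[0,1]\times[0,1]$ with first marginal $\mu$ and second marginal $\nu$. $\mathcal{G}_0\subset L^2([0,1])$ is the set of right continuous, nondecreasing functions $g:[0,1]\to[0,1]$ with $g(1)=1$ (regarded as elements of $L^2([0,1])$; distinct such functions define distinct elements of $L^2$), and $d^{L^2}(f,g)=\|f-g\|_{L^2([0,1])}$. *)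

theory Defs
  imports "HOL-Probability.Probability"
begin

definition Leb :: "real measure" where
  "Leb = lebesgue_on {0..1}"

definition borel_I :: "real measure" where
  "borel_I = restrict_space borel {0..1}"

definition P0 :: "real measure set" where
  "P0 = {\<mu>. sets \<mu> = sets borel_I \<and> prob_space \<mu>}"

definition couplings :: "real measure \<Rightarrow> real measure \<Rightarrow> (real \<times> real) measure set" where
  "couplings \<mu> \<nu> = {\<pi>. sets \<pi> = sets (restrict_space borel ({0..1} \<times> {0..1})) \<and> prob_space \<pi> \<and>
     distr \<pi> borel_I fst = \<mu> \<and> distr \<pi> borel_I snd = \<nu>}"

text \<open>For \<open>\<mu>, \<nu> \<in> P0\<close> the infimum is over a nonempty set of reals in \<open>[0, 1]\<close>: the product
  measure is a coupling, and the integrand is bounded by 1 and measurable.\<close>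

definition dW :: "real measure \<Rightarrow> real measure \<Rightarrow> real" where
  "dW \<mu> \<nu> = sqrt (INF \<pi>\<in>couplings \<mu> \<nu>. \<integral>z. \<bar>fst z - snd z\<bar>\<^sup>2 \<partial>\<pi>)"

text \<open>A function on \<open>[0, 1]\<close> is an extensional function (equal to \<open>undefined\<close> off \<open>[0, 1]\<close>), so that
  HOL equality of elements of \<open>G0\<close> is equality on \<open>[0, 1]\<close>. As a right continuous function with
  \<open>g 1 = 1\<close> is determined by its class in \<open>L\<^sup>2\<close>, no quotient by equality almost everywhere is
  taken.\<close>

definition G0 :: "(real \<Rightarrow> real) set" where
  "G0 = {g \<in> {0..1} \<rightarrow>\<^sub>E {0..1}. mono_on {0..1} g \<and>
     (\<forall>t\<in>{0..<1}. continuous (at_right t) g) \<and> g 1 = 1}"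

definition dL2 :: "(real \<Rightarrow> real) \<Rightarrow> (real \<Rightarrow> real) \<Rightarrow> real" where
  "dL2 f g = sqrt (\<integral>t. \<bar>f t - g t\<bar>\<^sup>2 \<partial>Leb)"

definition Psi :: "(real \<Rightarrow> real) \<Rightarrow> real measure" where
  "Psi g = distr Leb borel_I g"

text \<open>The empty case is explicit because \<open>Inf {}\<close> is unspecified for reals.\<close>

definition inv_distr :: "real measure \<Rightarrow> real \<Rightarrow> real" where
  "inv_distr \<mu> = (\<lambda>t\<in>{0..1}. let S = {s \<in> {0..1}. measure \<mu> {0..s} > t} in
     if S = {} then 1 else Inf S)"

end

theory Submission
  imports Defs
begin

text \<open>Bijectivity rests on \<open>t < \<mu>[0, s] \<Longrightarrow> inv_distr \<mu> t \<le> s\<close> and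
  \<open>inv_distr \<mu> t < s \<Longrightarrow> t < \<mu>[0, s]\<close> together with right continuity. For the isometry, the
  marginals of a coupling \<open>\<pi>\<close> of \<open>Psi f\<close> and \<open>Psi g\<close> determine the integrals of \<open>x\<^sup>2\<close> and \<open>y\<^sup>2\<close>, so
  minimising the cost means maximising \<open>\<integral>xy d\<pi>\<close>, which by the layer cake formula is the integral
  over \<open>a, b \<ge> 0\<close> of \<open>\<pi>(x > a, y > b) \<le> min (\<pi>(x > a)) (\<pi>(y > b))\<close>. The coupling
  \<open>(f, g)\<^sub>*Leb\<close> attains this bound because superlevel sets of nondecreasing functions are
  nested.\<close>

section \<open>Layer cake formula for products and expansion of the quadratic cost\<close>

lemma nn_integral_mult_eq_tails:
  fixes X Y :: "'a \<Rightarrow> real"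
  assumes "sigma_finite_measure M"
    and [measurable]: "X \<in> borel_measurable M" "Y \<in> borel_measurable M"
    and nonneg: "\<And>x. x \<in> space M \<Longrightarrow> 0 \<le> X x" "\<And>x. x \<in> space M \<Longrightarrow> 0 \<le> Y x"
  shows "(\<integral>\<^sup>+x. ennreal (X x * Y x) \<partial>M) =
    (\<integral>\<^sup>+a. \<integral>\<^sup>+b. indicator {0..} a * indicator {0..} b *
      emeasure M {x \<in> space M. a < X x \<and> b < Y x} \<partial>lborel \<partial>lborel)"
proof -
  interpret M: sigma_finite_measure M by fact
  interpret P: pair_sigma_finite M lborel ..
  \<comment> \<open>For fixed \<open>x\<close> this is the indicator of the rectangle with opposite
    corners at the origin and \<open>(X x, Y x)\<close>. By nonnegativity its area is
    \<open>X x * Y x\<close>, and two applications of Fubini then move the integral over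
    \<open>M\<close> innermost.\<close>
  let ?h = "\<lambda>x a b. if 0 \<le> a \<and> a < X x \<and> 0 \<le> b \<and> b < Y x then 1 else 0 :: ennreal"
  have "(\<integral>\<^sup>+x. ennreal (X x * Y x) \<partial>M) = (\<integral>\<^sup>+x. \<integral>\<^sup>+a. \<integral>\<^sup>+b. ?h x a b \<partial>lborel \<partial>lborel \<partial>M)"
  proof (rule nn_integral_cong)
    fix x assume x: "x \<in> space M"
    have "(\<integral>\<^sup>+a. \<integral>\<^sup>+b. ?h x a b \<partial>lborel \<partial>lborel) =
      (\<integral>\<^sup>+a. \<integral>\<^sup>+b. indicator {0..<X x} a * indicator {0..<Y x} b \<partial>lborel \<partial>lborel)"
      by (intro nn_integral_cong) (auto simp: indicator_def)
    also have "\<dots> = ennreal (X x) * ennreal (Y x)"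
      using nonneg[OF x] by (simp add: nn_integral_cmult nn_integral_multc)
    finally show "ennreal (X x * Y x) = (\<integral>\<^sup>+a. \<integral>\<^sup>+b. ?h x a b \<partial>lborel \<partial>lborel)"
      using nonneg[OF x] by (simp add: ennreal_mult)
  qed
  also have "\<dots> = (\<integral>\<^sup>+a. \<integral>\<^sup>+x. \<integral>\<^sup>+b. ?h x a b \<partial>lborel \<partial>M \<partial>lborel)"
    by (rule P.Fubini'[symmetric]) measurable
  also have "\<dots> = (\<integral>\<^sup>+a. \<integral>\<^sup>+b. \<integral>\<^sup>+x. ?h x a b \<partial>M \<partial>lborel \<partial>lborel)"
    by (intro nn_integral_cong P.Fubini'[symmetric]) measurable
  also have "\<dots> = (\<integral>\<^sup>+a. \<integral>\<^sup>+b. indicator {0..} a * indicator {0..} b *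
      emeasure M {x \<in> space M. a < X x \<and> b < Y x} \<partial>lborel \<partial>lborel)"
  proof (intro nn_integral_cong)
    fix a b :: real
    have "(\<integral>\<^sup>+x. ?h x a b \<partial>M) = (\<integral>\<^sup>+x. indicator {0..} a * indicator {0..} b *
        indicator {x \<in> space M. a < X x \<and> b < Y x} x \<partial>M)"
      by (intro nn_integral_cong) (auto simp: indicator_def)
    then show "(\<integral>\<^sup>+x. ?h x a b \<partial>M) = indicator {0..} a * indicator {0..} b *
        emeasure M {x \<in> space M. a < X x \<and> b < Y x}"
      by (simp add: nn_integral_cmult)
  qed
  finally show ?thesis .
qed

text \<open>Isolates the cross term: the two second moments each involve one variable only, so for
  couplings they are fixed by the marginals. Values in the unit interval over a finite measure make
  all three products integrable.\<close>

lemma integral_diff_square: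
  fixes X Y :: "'a \<Rightarrow> real"
  assumes "finite_measure M"
    and [measurable]: "X \<in> borel_measurable M" "Y \<in> borel_measurable M"
    and bounds: "\<And>x. x \<in> space M \<Longrightarrow> X x \<in> {0..1}" "\<And>x. x \<in> space M \<Longrightarrow> Y x \<in> {0..1}"
  shows "integrable M (\<lambda>x. X x * Y x)"
    and "(\<integral>x. \<bar>X x - Y x\<bar>\<^sup>2 \<partial>M) = (\<integral>x. (X x)\<^sup>2 \<partial>M) + (\<integral>x. (Y x)\<^sup>2 \<partial>M) - 2 * (\<integral>x. X x * Y x \<partial>M)"
proof -
  interpret finite_measure M by fact
  have int: "integrable M (\<lambda>x. U x * V x)"
    if [measurable]: "U \<in> borel_measurable M" "V \<in> borel_measurable M"
      and "\<And>x. x \<in> space M \<Longrightarrow> U x \<in> {0..1}" "\<And>x. x \<in> space M \<Longrightarrow> V x \<in> {0..1}" for U V :: "'a \<Rightarrow> real"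
    using that by (intro integrable_const_bound[where B = 1]) (auto intro!: mult_le_one)
  note XY = int[of X Y] int[of X X] int[of Y Y]
  show "integrable M (\<lambda>x. X x * Y x)" using XY bounds by auto
  have "(\<integral>x. \<bar>X x - Y x\<bar>\<^sup>2 \<partial>M) = (\<integral>x. X x * X x + Y x * Y x - 2 * (X x * Y x) \<partial>M)"
    by (intro Bochner_Integration.integral_cong) (auto simp: power2_eq_square algebra_simps)
  also have "\<dots> = (\<integral>x. X x * X x \<partial>M) + (\<integral>x. Y x * Y x \<partial>M) - 2 * (\<integral>x. X x * Y x \<partial>M)"
    using XY bounds by simp
  finally show "(\<integral>x. \<bar>X x - Y x\<bar>\<^sup>2 \<partial>M) = (\<integral>x. (X x)\<^sup>2 \<partial>M) + (\<integral>x. (Y x)\<^sup>2 \<partial>M) - 2 * (\<integral>x. X x * Y x \<partial>M)"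
    by (simp add: power2_eq_square)
qed

section \<open>Basic facts on \<open>Leb\<close>, \<open>P0\<close>, \<open>G0\<close> and
  \<open>Psi\<close>\<close>

lemma space_borel_I [simp]: "space borel_I = {0..1}"
  by (simp add: borel_I_def space_restrict_space)

lemma space_Leb [simp]: "space Leb = {0..1}"
  by (simp add: Leb_def)

lemma prob_space_Leb: "prob_space Leb"
  by (rule prob_spaceI) (simp add: Leb_def emeasure_restrict_space)

lemma measure_Leb:
  assumes "A \<in> sets borel" "A \<subseteq> {0..1}"
  shows "measure Leb A = measure lborel A"
  using assms by (simp add: Leb_def measure_restrict_space)

lemma P0_D:
  assumes "\<mu> \<in> P0"
  shows "sets \<mu> = sets borel_I" "space \<mu> = {0..1}" "prob_space \<mu>"
  using assms sets_eq_imp_space_eq[of \<mu> borel_I] by (auto simp: P0_def)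

lemma G0_D:
  assumes "g \<in> G0"
  shows "t \<in> {0..1} \<Longrightarrow> g t \<in> {0..1}" "mono_on {0..1} g" "g 1 = 1" "g \<in> extensional {0..1}"
    "t \<in> {0..<1} \<Longrightarrow> continuous (at_right t) g"
  using assms by (auto simp: G0_def PiE_def Pi_def)

lemma G0_measurable_borel [measurable]:
  assumes "g \<in> G0"
  shows "g \<in> borel_measurable Leb"
proof -
  \<comment> \<open>\<open>Leb\<close> carries the completed sigma-algebra, while monotonicity gives
    measurability for the Borel one; composing with the identity passes between the two.\<close>
  have "(\<lambda>x. x) \<in> measurable Leb (restrict_space borel {0..1})"
    unfolding Leb_def by (intro measurable_restrict_space3 measurable_completion) auto
  then show ?thesis
    using borel_measurable_mono_on_fnc[OF G0_D(2)[OF assms]] by (rule measurable_compose)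
qed

lemma G0_measurable [measurable]:
  assumes "g \<in> G0"
  shows "g \<in> measurable Leb borel_I"
  unfolding borel_I_def
  using G0_D(1)[OF assms] by (intro measurable_restrict_space2 G0_measurable_borel assms) auto

lemma Psi_in_P0:
  assumes "g \<in> G0"
  shows "Psi g \<in> P0"
  using prob_space.prob_space_distr[OF prob_space_Leb G0_measurable[OF assms]]
  by (simp add: P0_def Psi_def)

lemma measure_Psi:
  assumes "g \<in> G0" "s \<in> {0..1}"
  shows "measure (Psi g) {0..s} = measure Leb {t \<in> {0..1}. g t \<le> s}"
proof -
  have "{0..s} \<in> sets borel_I"
    using assms by (auto simp: borel_I_def sets_restrict_space_iff)
  moreover have "g -` {0..s} \<inter> space Leb = {t \<in> {0..1}. g t \<le> s}"
    using G0_D(1)[OF assms(1)] by fastforce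
  ultimately show ?thesis
    using assms by (simp add: Psi_def measure_distr)
qed

section \<open>Inverse distribution functions\<close>

lemma inv_distr_extensional: "inv_distr \<mu> \<in> extensional {0..1}"
  unfolding inv_distr_def by (rule restrict_extensional)

lemma inv_distr_eq:
  assumes "t \<in> {0..1}"
  shows "inv_distr \<mu> t =
    (let S = {s \<in> {0..1}. measure \<mu> {0..s} > t} in if S = {} then 1 else Inf S)"
  unfolding inv_distr_def by (rule restrict_apply'[OF assms])

text \<open>For \<open>t < 1\<close> the infimum equals \<open>g t\<close> by two bounds. If
  \<open>s < g t\<close>, monotonicity confines the set where \<open>g\<close> is at most
  \<open>s\<close> to \<open>{0..t}\<close>, whose measure does not exceed \<open>t\<close>. If
  \<open>g t < s\<close>, right continuity keeps \<open>g\<close> below \<open>s\<close> slightly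
  beyond \<open>t\<close>, so that set has measure above \<open>t\<close>.\<close>

lemma inv_distr_Psi:
  assumes g: "g \<in> G0"
  shows "inv_distr (Psi g) = g"
proof
  fix t
  interpret prob_space Leb by (rule prob_space_Leb)
  define S where "S = {s \<in> {0..1}. measure (Psi g) {0..s} > t}"
  have meas: "{u \<in> {0..1}. g u \<le> s} \<in> sets Leb" for s
    using g measurable_sets[OF G0_measurable_borel[OF g], of "{..s}"] by (simp add: vimage_def Int_def conj_commute)
  consider "t \<notin> {0..1}" | "t = 1" | "t \<in> {0..<1}" by fastforce
  then show "inv_distr (Psi g) t = g t"
  proof cases
    case 1
    then show ?thesis using extensional_arb[OF G0_D(4)[OF g]] extensional_arb[OF inv_distr_extensional] by metis
  next
    case 2
    \<comment> \<open>No probability exceeds 1, so the convention for the empty set applies at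
      \<open>t = 1\<close> and agrees with \<open>g 1 = 1\<close>.\<close>
    have "S = {}"
      using prob_space.prob_le_1[OF P0_D(3)[OF Psi_in_P0[OF g]]] 2 by (auto simp: S_def not_less)
    then show ?thesis using 2 G0_D(3)[OF g] inv_distr_eq[of t "Psi g", folded S_def] by simp
  next
    case t: 3
    have le: "g t \<le> s" if "s \<in> S" for s
    proof (rule ccontr)
      assume "\<not> g t \<le> s"
      then have sub: "{u \<in> {0..1}. g u \<le> s} \<subseteq> {0..t}"
        using mono_onD[OF G0_D(2)[OF g], of t] t by force
      have "measure Leb {u \<in> {0..1}. g u \<le> s} \<le> measure Leb {0..t}"
        using t by (intro finite_measure_mono[OF sub]) (auto simp: Leb_def sets_restrict_space_iff)
      also have "\<dots> = t" using t by (subst measure_Leb) auto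
      finally show False using that by (auto simp: S_def measure_Psi[OF g])
    qed
    have mem: "s \<in> S" if s: "g t < s" "s \<le> 1" for s
    proof -
      have "0 \<le> s" using s G0_D(1)[OF g, of t] t by auto
      have "eventually (\<lambda>u. g u < s) (at_right t)"
        using G0_D(5)[OF g t] s by (auto simp: continuous_within intro: order_tendstoD)
      then obtain b where b: "t < b" "\<And>u. t < u \<Longrightarrow> u < b \<Longrightarrow> g u < s"
        by (auto simp: eventually_at_right_field)
      \<comment> \<open>The midpoint lies strictly beyond \<open>t\<close>, so \<open>{0..c}\<close>
        has measure greater than \<open>t\<close>, yet below \<open>b\<close> and 1, so
        \<open>g c < s\<close>.\<close>
      define c where "c = (t + min b 1) / 2"
      have c: "t < c" "c < b" "c < 1" using b(1) t by (auto simp: c_def min_def)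
      have "{0..c} \<subseteq> {u \<in> {0..1}. g u \<le> s}"
        using mono_onD[OF G0_D(2)[OF g], of _ c] b(2)[of c] c t by force
      then have "measure Leb {0..c} \<le> measure Leb {u \<in> {0..1}. g u \<le> s}"
        by (intro finite_measure_mono meas)
      moreover have "measure Leb {0..c} = c" using c t by (subst measure_Leb) auto
      ultimately show ?thesis using c(1) \<open>0 \<le> s\<close> s by (simp add: S_def measure_Psi[OF g])
    qed
    have "measure (Psi g) {0..1} = 1"
      using prob_space.prob_space[OF P0_D(3)[OF Psi_in_P0[OF g]]] P0_D(2)[OF Psi_in_P0[OF g]] by simp
    then have one: "1 \<in> S" using t by (simp add: S_def)
    have "Inf S = g t"
    proof (rule cInf_eq_non_empty)
      fix y assume y: "\<And>x. x \<in> S \<Longrightarrow> y \<le> x"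
      show "y \<le> g t"
      proof (rule dense_ge)
        fix s assume "g t < s"
        \<comment> \<open>When \<open>s > 1\<close>, \<open>s\<close> is not in \<open>S\<close> and
          the bound comes from \<open>1 \<in> S\<close> instead.\<close>
        then show "y \<le> s"
          using mem[of s] y[of s] y[OF one] by (cases "s \<le> 1") auto
      qed
    qed (use one le in auto)
    then show ?thesis using t one inv_distr_eq[of t "Psi g", folded S_def] by (auto simp: Let_def)
  qed
qed

text \<open>With \<open>t < 1\<close> the point 1 belongs to the set in the definition, so a genuine
  infimum is taken. The last implication has a strict hypothesis because the infimum need not belong
  to the set: for uniform \<mu> it is \<open>t\<close> itself, where the distribution function
  equals \<open>t\<close>.\<close>

lemma inv_distr_props:
  assumes "\<mu> \<in> P0" and t: "t \<in> {0..<1}"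
  shows inv_distr_mem: "inv_distr \<mu> t \<in> {0..1}"
    and inv_distr_le: "s \<in> {0..1} \<Longrightarrow> t < measure \<mu> {0..s} \<Longrightarrow> inv_distr \<mu> t \<le> s"
    and less_measure_if_inv_distr_less: "s \<in> {0..1} \<Longrightarrow> inv_distr \<mu> t < s \<Longrightarrow> t < measure \<mu> {0..s}"
proof -
  interpret prob_space \<mu> using P0_D[OF assms(1)] by simp
  define S where "S = {s \<in> {0..1}. measure \<mu> {0..s} > t}"
  have one: "1 \<in> S" using prob_space P0_D(2)[OF assms(1)] t by (simp add: S_def)
  have eq: "inv_distr \<mu> t = Inf S" using t one inv_distr_eq[of t \<mu>, folded S_def] by (auto simp: Let_def)
  have bdd: "bdd_below S" by (auto simp: S_def)
  have "0 \<le> Inf S" using one by (intro cInf_greatest) (auto simp: S_def)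
  then show "inv_distr \<mu> t \<in> {0..1}" using cInf_lower[OF one bdd] by (simp add: eq)
  show "inv_distr \<mu> t \<le> s" if "s \<in> {0..1}" "t < measure \<mu> {0..s}"
    unfolding eq using that by (intro cInf_lower bdd) (auto simp: S_def)
  show "t < measure \<mu> {0..s}" if s: "s \<in> {0..1}" "inv_distr \<mu> t < s"
  proof -
    obtain r where "r \<in> S" "r < s" using s cInf_lessD[of S s] one eq by auto
    moreover have "measure \<mu> {0..r} \<le> measure \<mu> {0..s}"
      using \<open>r < s\<close> s P0_D(1)[OF assms(1)]
      by (intro finite_measure_mono) (auto simp: borel_I_def sets_restrict_space_iff)
    ultimately show ?thesis by (auto simp: S_def)
  qed
qed

lemma inv_distr_1:
  assumes "\<mu> \<in> P0"
  shows "inv_distr \<mu> 1 = 1"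
  using prob_space.prob_le_1[OF P0_D(3)[OF assms]] by (simp add: inv_distr_eq Let_def not_less)

lemma inv_distr_mono:
  assumes "\<mu> \<in> P0" "0 \<le> t" "t \<le> u" "u \<le> 1"
  shows "inv_distr \<mu> t \<le> inv_distr \<mu> u"
proof (cases "u = 1")
  case True
  then show ?thesis
    using inv_distr_1[OF assms(1)] inv_distr_mem[OF assms(1), of t] assms by (cases "t = 1") auto
next
  case False
  then have tu: "t \<in> {0..<1}" "u \<in> {0..<1}" using assms by auto
  show ?thesis
  proof (rule ccontr)
    \<comment> \<open>A point \<open>s\<close> strictly between the two values exceeds the one at
      \<open>u\<close>, so \<open>u\<close>, and hence \<open>t\<close>, is below the mass of
      \<open>{0..s}\<close>. That forces the value at \<open>t\<close> to be at most
      \<open>s\<close>.\<close>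
    assume "\<not> ?thesis"
    then obtain s where s: "inv_distr \<mu> u < s" "s < inv_distr \<mu> t"
      using dense by (auto simp: not_le)
    then have "s \<in> {0..1}"
      using inv_distr_mem[OF assms(1) tu(1)] inv_distr_mem[OF assms(1) tu(2)] by auto
    then show False
      using s less_measure_if_inv_distr_less[OF assms(1) tu(2), of s] inv_distr_le[OF assms(1) tu(1), of s] assms by auto
  qed
qed

text \<open>The substance is right continuity. Lower bounds persist to the right by monotonicity;
  upper bounds persist because, for fixed \<open>s\<close>, the condition
  \<open>t < measure \<mu> {0..s}\<close> is open in \<open>t\<close>.\<close>

lemma inv_distr_in_G0:
  assumes \<mu>: "\<mu> \<in> P0"
  shows "inv_distr \<mu> \<in> G0"
proof -
  have "inv_distr \<mu> \<in> {0..1} \<rightarrow>\<^sub>E {0..1}"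
  proof (rule PiE_I)
    show "inv_distr \<mu> t \<in> {0..1}" if "t \<in> {0..1}" for t
      using inv_distr_mem[OF \<mu>, of t] inv_distr_1[OF \<mu>] that by (cases "t = 1") auto
  qed (rule extensional_arb[OF inv_distr_extensional])
  moreover have "mono_on {0..1} (inv_distr \<mu>)"
    using inv_distr_mono[OF \<mu>] by (intro mono_onI) auto
  moreover have "continuous (at_right t) (inv_distr \<mu>)" if t: "t \<in> {0..<1}" for t
    unfolding continuous_within
  proof (rule order_tendstoI)
    fix a assume "a < inv_distr \<mu> t"
    then have "a < inv_distr \<mu> u" if "t < u" "u < 1" for u
      using inv_distr_mono[OF \<mu>, of t u] t that by auto
    then show "eventually (\<lambda>u. a < inv_distr \<mu> u) (at_right t)"
      using t by (auto simp: eventually_at_right_field)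
  next
    fix a assume a: "inv_distr \<mu> t < a"
    show "eventually (\<lambda>u. inv_distr \<mu> u < a) (at_right t)"
    proof (cases "a \<le> 1")
      case True
      obtain s where s: "inv_distr \<mu> t < s" "s < a" using a dense by blast
      have s01: "s \<in> {0..1}" using s True inv_distr_mem[OF \<mu> t] by auto
      have less: "t < measure \<mu> {0..s}" using less_measure_if_inv_distr_less[OF \<mu> t s01 s(1)] .
      have "inv_distr \<mu> u < a" if "t < u" "u < measure \<mu> {0..s}" for u
      proof -
        have "measure \<mu> {0..s} \<le> 1" using prob_space.prob_le_1[OF P0_D(3)[OF \<mu>]] by simp
        then show ?thesis using inv_distr_le[OF \<mu> _ s01, of u] that t s by auto
      qed
      then show ?thesis using less by (auto simp: eventually_at_right_field)
    next
      case False
      then have "inv_distr \<mu> u < a" if "t < u" "u < 1" for u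
        using inv_distr_mem[OF \<mu>, of u] t that by auto
      then show ?thesis using t by (auto simp: eventually_at_right_field)
    qed
  qed
  ultimately show ?thesis using inv_distr_1[OF \<mu>] by (simp add: G0_def)
qed

section \<open>Recovering a measure from its inverse distribution function\<close>

lemma P0_eqI:
  assumes "\<mu> \<in> P0" "\<nu> \<in> P0"
    and eq: "\<And>s. 0 \<le> s \<Longrightarrow> s < 1 \<Longrightarrow> measure \<mu> {0..s} = measure \<nu> {0..s}"
  shows "\<mu> = \<nu>"
proof -
  \<comment> \<open>Pushing forward along the inclusion into the real line makes uniqueness of
    cumulative distribution functions available. These are 0 on the negative axis and 1 from 1
    onwards, so only \<open>0 \<le> s < 1\<close> has to be compared.\<close>
  have meas: "(\<lambda>x. x) \<in> borel_measurable \<rho>" if "\<rho> \<in> P0" for \<rho>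
    using P0_D(1)[OF that] measurable_restrict_space1[of "\<lambda>x. x" borel borel "{0..1}"]
    by (simp add: borel_I_def cong: measurable_cong_sets)
  have real: "real_distribution (distr \<rho> borel (\<lambda>x. x))" if "\<rho> \<in> P0" for \<rho>
    using prob_space.real_distribution_distr[OF P0_D(3)[OF that] meas[OF that]] .
  have cdf: "cdf (distr \<rho> borel (\<lambda>x. x)) s = (if s < 0 then 0 else if s < 1 then measure \<rho> {0..s} else 1)"
    if \<rho>: "\<rho> \<in> P0" for \<rho> s
  proof -
    have "{..s} \<inter> {0..1} = (if s < 0 then {} else if s < 1 then {0..s} else {0..1})" by auto
    then show ?thesis
      using meas[OF \<rho>] prob_space.prob_space[OF P0_D(3)[OF \<rho>]] P0_D(2)[OF \<rho>]
      by (simp add: cdf_def measure_distr)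
  qed
  have "distr \<mu> borel (\<lambda>x. x) = distr \<nu> borel (\<lambda>x. x)"
    using real assms cdf by (intro cdf_unique) (auto simp: fun_eq_iff)
  moreover have "emeasure \<rho> A = emeasure (distr \<rho> borel (\<lambda>x. x)) A" if "\<rho> \<in> P0" "A \<in> sets borel_I" for \<rho> A
  proof -
    have "A \<in> sets borel" "A \<subseteq> {0..1}"
      using that(2) by (auto simp: borel_I_def sets_restrict_space_iff)
    then show ?thesis
      using meas[OF that(1)] P0_D(2)[OF that(1)] by (simp add: emeasure_distr Int_absorb2)
  qed
  ultimately show ?thesis
    using assms P0_D(1) by (intro measure_eqI) auto
qed

text \<open>With \<open>F\<close> the distribution function of \<mu>, the set where
  \<open>inv_distr \<mu>\<close> is at most \<open>s\<close> lies between \<open>{0..<F s}\<close>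
  and \<open>{0..F s}\<close>. Both have measure \<open>F s\<close>, so the unknown endpoint does
  not matter.\<close>

lemma Psi_inv_distr:
  assumes \<mu>: "\<mu> \<in> P0"
  shows "Psi (inv_distr \<mu>) = \<mu>"
proof (rule P0_eqI)
  let ?g = "inv_distr \<mu>"
  have g: "?g \<in> G0" using inv_distr_in_G0[OF \<mu>] .
  show "Psi ?g \<in> P0" by (rule Psi_in_P0[OF g])
  show "\<mu> \<in> P0" by fact
  interpret \<mu>: prob_space \<mu> using P0_D[OF \<mu>] by simp
  interpret L: prob_space Leb by (rule prob_space_Leb)
  fix s :: real assume s: "0 \<le> s" "s < 1"
  define F where "F = (\<lambda>s. measure \<mu> {0..s})"
  have F01: "F s \<in> {0..1}" by (simp add: F_def)
  have low: "{0..<F s} \<subseteq> {t \<in> {0..1}. ?g t \<le> s}"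
    proof
    fix t assume "t \<in> {0..<F s}"
    moreover from this have "t < 1" using F01 by simp
    ultimately show "t \<in> {t \<in> {0..1}. ?g t \<le> s}"
      using F01 s inv_distr_le[OF \<mu>, of t s] by (auto simp: F_def)
  qed
  have up: "{t \<in> {0..1}. ?g t \<le> s} \<subseteq> {0..F s}"
  proof safe
    fix t assume t: "t \<in> {0..1}" "?g t \<le> s"
    have "t \<noteq> 1" using t s inv_distr_1[OF \<mu>] by auto
    then have t1: "t \<in> {0..<1}" using t by auto
    \<comment> \<open>The available implication needs a strict inequality, so it is applied at
      points \<open>r n\<close> decreasing to \<open>s\<close>; continuity from above of \<mu> then
      gives \<open>t \<le> F s\<close>. The factor \<open>1 - s\<close> keeps \<open>r n\<close>
      inside the unit interval.\<close>
    define r where "r = (\<lambda>n. s + (1 - s) / real (Suc n))"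
    have r: "s < r n" "r n \<le> 1" for n
      using s mult_left_le_one_le[of "real n" s] by (auto simp: r_def field_simps)
    have lim: "r \<longlonglongrightarrow> s"
      using tendsto_add[OF tendsto_const tendsto_mult[OF tendsto_const LIMSEQ_inverse_real_of_nat], of s "1 - s"]
      by (simp add: r_def divide_inverse)
    have "(\<Inter>n. {0..r n}) = {0..s}"
    proof safe
      fix x assume x: "x \<in> (\<Inter>n. {0..r n})"
      then have "x \<le> s" using LIMSEQ_le_const[OF lim, of x] by auto
      then show "x \<in> {0..s}" using x by auto
    next
      fix x n assume "x \<in> {0..s}"
      then show "x \<in> {0..r n}" using r(1)[of n] by auto
    qed
    moreover have "decseq (\<lambda>n. {0..r n})"
    proof (rule decseq_SucI)
      fix n
      have "r (Suc n) \<le> r n" unfolding r_def using s by (intro add_left_mono divide_left_mono) auto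
      then show "{0..r (Suc n)} \<subseteq> {0..r n}" by simp
    qed
    ultimately have "(\<lambda>n. F (r n)) \<longlonglongrightarrow> F s"
      using r P0_D(1)[OF \<mu>] \<mu>.finite_Lim_measure_decseq[of "\<lambda>n. {0..r n}"]
      by (auto simp: F_def borel_I_def sets_restrict_space_iff image_subset_iff)
    moreover have "t \<le> F (r n)" for n
      using less_measure_if_inv_distr_less[OF \<mu> t1, of "r n"] r[of n] t s by (auto simp: F_def)
    ultimately have "t \<le> F s" by (intro LIMSEQ_le_const) auto
    then show "t \<in> {0..F s}" using t by auto
  qed
  have meas: "{t \<in> {0..1}. ?g t \<le> s} \<in> sets Leb"
    using measurable_sets[OF G0_measurable_borel[OF g], of "{..s}"] by (simp add: vimage_def Int_def conj_commute)
  have "measure Leb {0..<F s} \<le> measure Leb {t \<in> {0..1}. ?g t \<le> s}"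
    by (intro L.finite_measure_mono low meas)
  moreover have "measure Leb {t \<in> {0..1}. ?g t \<le> s} \<le> measure Leb {0..F s}"
    using F01 by (intro L.finite_measure_mono up) (auto simp: Leb_def sets_restrict_space_iff)
  moreover have "measure Leb {0..<F s} = F s" "measure Leb {0..F s} = F s"
    using F01 by (subst measure_Leb; force)+
  ultimately have "measure Leb {t \<in> {0..1}. ?g t \<le> s} = F s" by linarith
  then show "measure (Psi ?g) {0..s} = measure \<mu> {0..s}"
    using s by (simp add: measure_Psi[OF g] F_def)
qed

section \<open>Optimality of the monotone coupling and the isometry\<close>

lemma emeasure_joint_tail_G0:
  assumes f: "f \<in> G0" and g: "g \<in> G0"
  shows "emeasure Leb {t \<in> {0..1}. a < f t \<and> b < g t} =
    min (emeasure Leb {t \<in> {0..1}. a < f t}) (emeasure Leb {t \<in> {0..1}. b < g t})"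
proof -
  let ?A = "{t \<in> {0..1}. a < f t}" and ?B = "{t \<in> {0..1}. b < g t}"
  have AB: "?A \<in> sets Leb" "?B \<in> sets Leb"
    using measurable_sets[OF G0_measurable_borel[OF f], of "{a<..}"]
      measurable_sets[OF G0_measurable_borel[OF g], of "{b<..}"]
    by (simp_all add: vimage_def Int_def conj_commute)
  \<comment> \<open>Points \<open>u\<close> in \<open>?A\<close> but not \<open>?B\<close> and
    \<open>v\<close> in \<open>?B\<close> but not \<open>?A\<close> would violate monotonicity of
    \<open>f\<close> if \<open>u \<le> v\<close>, and of \<open>g\<close> otherwise.\<close>
  have "?A \<subseteq> ?B \<or> ?B \<subseteq> ?A"
  proof (rule ccontr)
    assume "\<not> ?thesis"
    then obtain u v where uv: "u \<in> ?A" "u \<notin> ?B" "v \<in> ?B" "v \<notin> ?A" by blast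
    then show False
      using mono_onD[OF G0_D(2)[OF f], of u v] mono_onD[OF G0_D(2)[OF g], of v u] by (cases "u \<le> v") auto
  qed
  then show ?thesis
  proof
    assume "?A \<subseteq> ?B"
    moreover from this have "{t \<in> {0..1}. a < f t \<and> b < g t} = ?A" by auto
    ultimately show ?thesis using emeasure_mono[of ?A ?B Leb] AB by (simp add: min_absorb1)
  next
    assume "?B \<subseteq> ?A"
    moreover from this have "{t \<in> {0..1}. a < f t \<and> b < g t} = ?B" by auto
    ultimately show ?thesis using emeasure_mono[of ?B ?A Leb] AB by (simp add: min_absorb2)
  qed
qed

lemma couplings_D:
  assumes "\<pi> \<in> couplings \<mu> \<nu>"
  shows "prob_space \<pi>" "space \<pi> = {0..1} \<times> {0..1}"
    "fst \<in> measurable \<pi> borel_I" "snd \<in> measurable \<pi> borel_I"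
    "distr \<pi> borel_I fst = \<mu>" "distr \<pi> borel_I snd = \<nu>"
proof -
  have sets: "sets \<pi> = sets (restrict_space borel ({0..1} \<times> {0..1}))"
    using assms by (simp add: couplings_def)
  show "space \<pi> = {0..1} \<times> {0..1}"
    using sets_eq_imp_space_eq[OF sets] by (simp add: space_restrict_space)
  show "fst \<in> measurable \<pi> borel_I" "snd \<in> measurable \<pi> borel_I"
    unfolding borel_I_def measurable_cong_sets[OF sets refl]
    by (auto intro!: measurable_restrict_space3 borel_measurable_continuous_onI continuous_intros)
qed (use assms in \<open>auto simp: couplings_def\<close>)

lemma transport_cost_ge:
  assumes f: "f \<in> G0" and g: "g \<in> G0" and \<pi>: "\<pi> \<in> couplings (Psi f) (Psi g)"
  shows "(\<integral>t. \<bar>f t - g t\<bar>\<^sup>2 \<partial>Leb) \<le> (\<integral>z. \<bar>fst z - snd z\<bar>\<^sup>2 \<partial>\<pi>)"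
proof -
  note D = couplings_D[OF \<pi>]
  interpret \<pi>: prob_space \<pi> by (rule D(1))
  interpret L: prob_space Leb by (rule prob_space_Leb)
  have borel: "h \<in> borel_measurable M" if "h \<in> measurable M borel_I" for h :: "'b \<Rightarrow> real" and M
    using that by (simp add: borel_I_def measurable_restrict_space2_iff)
  \<comment> \<open>Used for \<open>fst\<close> with \<open>f\<close> and for \<open>snd\<close>
    with \<open>g\<close>: equal pushforwards have equal tails and equal second moments.\<close>
  have transfer: "emeasure \<pi> {z \<in> space \<pi>. a < p z} = emeasure Leb {t \<in> {0..1}. a < h t}"
      "(\<integral>z. (p z)\<^sup>2 \<partial>\<pi>) = (\<integral>t. (h t)\<^sup>2 \<partial>Leb)"
    if p: "p \<in> measurable \<pi> borel_I" "distr \<pi> borel_I p = Psi h" and h: "h \<in> G0" for p h a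
  proof -
    have A: "{a<..} \<inter> {0..1} \<in> sets borel_I" by (auto simp: borel_I_def sets_restrict_space)
    have "emeasure \<pi> (p -` ({a<..} \<inter> {0..1}) \<inter> space \<pi>) = emeasure Leb (h -` ({a<..} \<inter> {0..1}) \<inter> space Leb)"
      using emeasure_distr[OF p(1) A] emeasure_distr[OF G0_measurable[OF h] A] p(2) by (simp add: Psi_def)
    moreover have "p -` ({a<..} \<inter> {0..1}) \<inter> space \<pi> = {z \<in> space \<pi>. a < p z}"
      using measurable_space[OF p(1), unfolded space_borel_I] by blast
    moreover have "h -` ({a<..} \<inter> {0..1}) \<inter> space Leb = {t \<in> {0..1}. a < h t}"
      using G0_D(1)[OF h] unfolding space_Leb by blast
    ultimately show "emeasure \<pi> {z \<in> space \<pi>. a < p z} = emeasure Leb {t \<in> {0..1}. a < h t}" by simp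
    have sq: "(\<lambda>x. x\<^sup>2) \<in> borel_measurable borel_I"
      unfolding borel_I_def by (intro measurable_restrict_space1) simp
    show "(\<integral>z. (p z)\<^sup>2 \<partial>\<pi>) = (\<integral>t. (h t)\<^sup>2 \<partial>Leb)"
      using integral_distr[OF p(1) sq] integral_distr[OF G0_measurable[OF h] sq] p(2) by (simp add: Psi_def)
  qed
  have mem: "fst z \<in> {0..1}" "snd z \<in> {0..1}" if "z \<in> space \<pi>" for z :: "real \<times> real"
    using that unfolding D(2) by auto
  have memL: "f t \<in> {0..1}" "g t \<in> {0..1}" if "t \<in> space Leb" for t
    using that G0_D(1)[OF f] G0_D(1)[OF g] unfolding space_Leb by blast+
  have nonneg: "z \<in> space \<pi> \<Longrightarrow> 0 \<le> fst z" "z \<in> space \<pi> \<Longrightarrow> 0 \<le> snd z" for z :: "real \<times> real"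
    using mem[of z] by simp_all
  have nonnegL: "t \<in> space Leb \<Longrightarrow> 0 \<le> f t" "t \<in> space Leb \<Longrightarrow> 0 \<le> g t" for t
    using memL[of t] by simp_all
  note \<pi>_sq = integral_diff_square[OF \<pi>.finite_measure_axioms borel[OF D(3)] borel[OF D(4)] mem]
  note L_sq = integral_diff_square[OF L.finite_measure_axioms borel[OF G0_measurable[OF f]]
    borel[OF G0_measurable[OF g]] memL]
  \<comment> \<open>For an arbitrary coupling a joint tail is at most the smaller marginal tail;
    under \<open>Leb\<close> the pair \<open>f\<close>, \<open>g\<close> attains this value for all
    thresholds at once.\<close>
  have tails: "emeasure \<pi> {z \<in> space \<pi>. a < fst z \<and> b < snd z} \<le> emeasure Leb {t \<in> space Leb. a < f t \<and> b < g t}" for a b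
  proof -
    have [measurable]: "fst \<in> borel_measurable \<pi>" "snd \<in> borel_measurable \<pi>"
      using D(3,4) borel by auto
    have "emeasure \<pi> {z \<in> space \<pi>. a < fst z \<and> b < snd z} \<le>
        min (emeasure \<pi> {z \<in> space \<pi>. a < fst z}) (emeasure \<pi> {z \<in> space \<pi>. b < snd z})"
      by (intro min.boundedI emeasure_mono) auto
    then show ?thesis
      using transfer(1)[OF D(3,5) f, of a] transfer(1)[OF D(4,6) g, of b] emeasure_joint_tail_G0[OF f g, of a b]
      by simp
  qed
  have "ennreal (\<integral>z. fst z * snd z \<partial>\<pi>) = (\<integral>\<^sup>+z. ennreal (fst z * snd z) \<partial>\<pi>)"
    using \<pi>_sq(1) by (intro nn_integral_eq_integral[symmetric] AE_I2 mult_nonneg_nonneg nonneg)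
  also have "\<dots> \<le> (\<integral>\<^sup>+t. ennreal (f t * g t) \<partial>Leb)"
  proof -
    have "(\<integral>\<^sup>+z. ennreal (fst z * snd z) \<partial>\<pi>) = (\<integral>\<^sup>+a. \<integral>\<^sup>+b. indicator {0..} a * indicator {0..} b *
        emeasure \<pi> {z \<in> space \<pi>. a < fst z \<and> b < snd z} \<partial>lborel \<partial>lborel)"
      by (intro nn_integral_mult_eq_tails \<pi>.sigma_finite_measure_axioms borel D nonneg)
    also have "\<dots> \<le> (\<integral>\<^sup>+a. \<integral>\<^sup>+b. indicator {0..} a * indicator {0..} b *
        emeasure Leb {t \<in> space Leb. a < f t \<and> b < g t} \<partial>lborel \<partial>lborel)"
      by (intro nn_integral_mono mult_left_mono tails) simp
    also have "\<dots> = (\<integral>\<^sup>+t. ennreal (f t * g t) \<partial>Leb)"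
      by (intro nn_integral_mult_eq_tails[symmetric] L.sigma_finite_measure_axioms
          G0_measurable_borel f g nonnegL)
    finally show ?thesis .
  qed
  also have "\<dots> = ennreal (\<integral>t. f t * g t \<partial>Leb)"
    using L_sq(1) by (intro nn_integral_eq_integral AE_I2 mult_nonneg_nonneg nonnegL)
  finally have le: "ennreal (\<integral>z. fst z * snd z \<partial>\<pi>) \<le> ennreal (\<integral>t. f t * g t \<partial>Leb)" .
  have "0 \<le> (\<integral>t. f t * g t \<partial>Leb)"
    by (intro Bochner_Integration.integral_nonneg mult_nonneg_nonneg nonnegL)
  with le have "(\<integral>z. fst z * snd z \<partial>\<pi>) \<le> (\<integral>t. f t * g t \<partial>Leb)"
    by (simp only: ennreal_le_iff)
  \<comment> \<open>After expanding both squares the second moments agree, so the upper bound on the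
    cross term becomes a lower bound on the cost.\<close>
  then show ?thesis
    using \<pi>_sq(2) L_sq(2) transfer(2)[OF D(3,5) f] transfer(2)[OF D(4,6) g] by linarith
qed

text \<open>The witness is the pushforward of \<open>Leb\<close> under the pair map of
  \<open>f\<close> and \<open>g\<close>; a change of variables turns its cost into the squared
  distance in \<open>dL2\<close>.\<close>

lemma monotone_coupling:
  assumes f: "f \<in> G0" and g: "g \<in> G0"
  obtains \<pi> where "\<pi> \<in> couplings (Psi f) (Psi g)"
    "(\<integral>z. \<bar>fst z - snd z\<bar>\<^sup>2 \<partial>\<pi>) = (\<integral>t. \<bar>f t - g t\<bar>\<^sup>2 \<partial>Leb)"
proof
  let ?B = "restrict_space borel ({0..1} \<times> {0..1}) :: (real \<times> real) measure"
  let ?p = "\<lambda>t. (f t, g t)"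
  have p: "?p \<in> measurable Leb ?B"
  proof (intro measurable_restrict_space2 borel_measurable_Pair G0_measurable_borel f g)
    show "?p \<in> space Leb \<rightarrow> {0..1} \<times> {0..1}"
      using G0_D(1)[OF f] G0_D(1)[OF g] unfolding space_Leb by blast
  qed
  have proj: "fst \<in> measurable ?B borel_I" "snd \<in> measurable ?B borel_I"
    unfolding borel_I_def
    by (auto intro!: measurable_restrict_space3 borel_measurable_continuous_onI continuous_intros)
  show "distr Leb ?B ?p \<in> couplings (Psi f) (Psi g)"
    using prob_space.prob_space_distr[OF prob_space_Leb p] distr_distr[OF proj(1) p] distr_distr[OF proj(2) p]
    by (simp add: couplings_def Psi_def comp_def)
  have "(\<lambda>z. \<bar>fst z - snd z\<bar>\<^sup>2) \<in> borel_measurable ?B"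
    by (intro measurable_restrict_space1 borel_measurable_continuous_onI continuous_intros)
  from integral_distr[OF p this]
  show "(\<integral>z. \<bar>fst z - snd z\<bar>\<^sup>2 \<partial>distr Leb ?B ?p) = (\<integral>t. \<bar>f t - g t\<bar>\<^sup>2 \<partial>Leb)"
    by simp
qed

lemma dW_Psi:
  assumes "f \<in> G0" "g \<in> G0"
  shows "dW (Psi f) (Psi g) = dL2 f g"
proof -
  obtain \<pi> where \<pi>: "\<pi> \<in> couplings (Psi f) (Psi g)"
    "(\<integral>z. \<bar>fst z - snd z\<bar>\<^sup>2 \<partial>\<pi>) = (\<integral>t. \<bar>f t - g t\<bar>\<^sup>2 \<partial>Leb)"
    using monotone_coupling[OF assms] .
  have "(INF \<pi>\<in>couplings (Psi f) (Psi g). \<integral>z. \<bar>fst z - snd z\<bar>\<^sup>2 \<partial>\<pi>) = (\<integral>t. \<bar>f t - g t\<bar>\<^sup>2 \<partial>Leb)"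
    \<comment> \<open>The infimum is a minimum, attained at the monotone coupling.\<close>
    using \<pi> transport_cost_ge[OF assms] by (intro cInf_eq_minimum) (auto intro: rev_image_eqI)
  then show ?thesis by (simp add: dW_def dL2_def)
qed

theorem proposition4p1:
  shows "bij_betw Psi G0 P0 \<and>
    (\<forall>f\<in>G0. \<forall>g\<in>G0. dW (Psi f) (Psi g) = dL2 f g) \<and>
    (\<forall>\<mu>\<in>P0. inv_into G0 Psi \<mu> = inv_distr \<mu>)"
proof -
  have bij: "bij_betw Psi G0 P0"
    using inv_distr_Psi Psi_inv_distr Psi_in_P0 inv_distr_in_G0
    by (intro bij_betw_byWitness[where f' = inv_distr]) auto
  \<comment> \<open>\<open>inv_into\<close> picks some preimage; injectivity identifies it with the
    explicit one.\<close>
  moreover have "inv_into G0 Psi \<mu> = inv_distr \<mu>" if "\<mu> \<in> P0" for \<mu>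
    using bij inv_distr_in_G0[OF that] Psi_inv_distr[OF that]
    by (intro inv_into_f_eq) (auto simp: bij_betw_def)
  ultimately show ?thesis using dW_Psi by blast
qed

end
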